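(* Any transitive compact system $(X,T)$ is Li-Yorke sensitive.
   Context: A dynamical system $(X,T)$ consists of a nonempty compact metric space $X$ (metric $d$) and a continuous surjective map $T:X\to X$; by standing assumption $X$ has no isolated points and is not a singleton. $\mathbb{Z}_+$ is the set of nonnegative integers. "Opene" means open and nonempty. For opene $U,V\subset X$ put $N_T(U,V)=\{n\in\mathbb{Z}_+: U\cap T^{-n}V\neq\varnothing\}$, and for $x\in X$, $G\subset X$ put $N_T(x,G)=\{n\in\mathbb{Z}_+: T^nx\in G\}$. The system is transitive compact if for every $x\in X$ there is $z\in X$ such that $N_T(x,G)\cap N_T(U,V)\neq\varnothing$ for every neighborhood $G$ of $z$ and all opene $U,V\subset X$. The system is Li-Yorke sensitive if there is $\delta>0$ such that for every $x\in X$ and every neighborhood $U_x$ of $x$ there is $y\in U_x$ with $\liminf_{n\to\infty}d(T^nx,T^ny)=0$ and $\limsup_{n\to\infty}d(T^nx,T^ny)>\delta$. *)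

theory Defs
  imports "HOL-Analysis.Analysis"
begin

text \<open>
  A metric space is represented by a carrier set \<open>X\<close> in a type of class \<open>metric_space\<close>, with the
  induced metric; openness and neighbourhoods are therefore relative to \<open>X\<close>. The map \<open>T\<close> is a
  total function of which only the values on \<open>X\<close> matter; \<open>T ^^ n\<close> is its \<open>n\<close>-th iterate.
\<close>

definition dynamical_system :: "'a::metric_space set \<Rightarrow> ('a \<Rightarrow> 'a) \<Rightarrow> bool" where
  "dynamical_system X T \<longleftrightarrow>
     X \<noteq> {} \<and> compact X \<and> continuous_on X T \<and> T ` X = X \<and>
     (\<forall>x\<in>X. x islimpt X) \<and> (\<nexists>a. X = {a})"

definition opene :: "'a::metric_space set \<Rightarrow> 'a set \<Rightarrow> bool" where
  "opene X U \<longleftrightarrow> openin (top_of_set X) U \<and> U \<noteq> {}"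

text \<open>Neighbourhoods need not be open.\<close>

definition neighborhood :: "'a::metric_space set \<Rightarrow> 'a \<Rightarrow> 'a set \<Rightarrow> bool" where
  "neighborhood X z G \<longleftrightarrow> G \<subseteq> X \<and> (\<exists>W. openin (top_of_set X) W \<and> z \<in> W \<and> W \<subseteq> G)"

definition hitting_times :: "('a \<Rightarrow> 'a) \<Rightarrow> 'a set \<Rightarrow> 'a set \<Rightarrow> nat set" where
  "hitting_times T U V = {n. U \<inter> (T ^^ n) -` V \<noteq> {}}"

definition visit_times :: "('a \<Rightarrow> 'a) \<Rightarrow> 'a \<Rightarrow> 'a set \<Rightarrow> nat set" where
  "visit_times T x G = {n. (T ^^ n) x \<in> G}"

definition transitive_compact :: "'a::metric_space set \<Rightarrow> ('a \<Rightarrow> 'a) \<Rightarrow> bool" where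
  "transitive_compact X T \<longleftrightarrow>
     (\<forall>x\<in>X. \<exists>z\<in>X. \<forall>G U V. neighborhood X z G \<and> opene X U \<and> opene X V \<longrightarrow>
        visit_times T x G \<inter> hitting_times T U V \<noteq> {})"

text \<open>
  The distances are embedded into \<open>ereal\<close>, a complete lattice, since \<open>liminf\<close> and \<open>limsup\<close> are not
  available on \<open>real\<close>.
\<close>

definition Li_Yorke_sensitive :: "'a::metric_space set \<Rightarrow> ('a \<Rightarrow> 'a) \<Rightarrow> bool" where
  "Li_Yorke_sensitive X T \<longleftrightarrow>
     (\<exists>\<delta>::real. \<delta> > 0 \<and> (\<forall>x\<in>X. \<forall>N. neighborhood X x N \<longrightarrow>
        (\<exists>y\<in>N. liminf (\<lambda>n. ereal (dist ((T ^^ n) x) ((T ^^ n) y))) = 0 \<and>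
               limsup (\<lambda>n. ereal (dist ((T ^^ n) x) ((T ^^ n) y))) > ereal \<delta>)))"

end

theory Submission
  imports Defs
begin

text \<open>
  Fix \<open>x\<close> and let \<open>z\<close> be the point that transitive compactness provides for it. Given an opene set
  \<open>U\<close>, a point \<open>v\<close> and \<open>r > 0\<close>, apply the defining property to \<open>U\<close>, the \<open>r\<close>-ball \<open>V\<close> about \<open>v\<close>
  and the \<open>r\<close>-ball \<open>G\<close> about \<open>z\<close>: at some single time \<open>n\<close> the orbit of \<open>x\<close> is \<open>r\<close>-close to \<open>z\<close>
  while the orbit of some \<open>y \<in> U\<close> is \<open>r\<close>-close to \<open>v\<close>. As \<open>U\<close> is arbitrary, the \<open>y\<close> with this
  property form a dense open set. The target \<open>v\<close> is free, although \<open>z\<close> is dictated by \<open>x\<close>, and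
  that freedom is what the proof exploits.

  Since \<open>X\<close> has no isolated points, the time \<open>n\<close> can moreover be required to be large
  (\<open>simultaneous_visits_late\<close>). The Baire category theorem then yields, in every opene set, a \<open>y\<close>
  for which all pairs \<open>(z, v)\<close>, with \<open>v\<close> in a prescribed countable set, are limit points of the
  orbit of \<open>(x, y)\<close> under \<open>T \<times> T\<close> (\<open>orbit_pair_accumulates\<close>).

  Two targets suffice. The target \<open>v = z\<close> forces the lower limit of the distances to be \<open>0\<close>. The
  target \<open>v = w\<close>, with \<open>w\<close> far from \<open>z\<close>, forces the upper limit to be at least the distance from \<open>z\<close>
  to \<open>w\<close>. For the sensitivity constant to be independent of \<open>x\<close>, fix two distinct points \<open>a\<close>, \<open>b\<close>
  beforehand: wherever \<open>z\<close> lies, one of them is at distance at least half of \<open>dist a b\<close> from it.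
\<close>

lemma continuous_on_funpow:
  fixes f :: "'a::topological_space \<Rightarrow> 'a"
  assumes "continuous_on S f" "f ` S \<subseteq> S"
  shows "continuous_on S (f ^^ n)"
proof (induction n)
  case (Suc n)
  have "(f ^^ n) ` S \<subseteq> S"
    using assms(2) by (induction n) auto
  then show ?case
    using Suc continuous_on_subset[OF assms(1)] by (auto intro: continuous_on_compose[unfolded o_def])
qed (simp add: id_def)

lemma openin_funpow_preimage:
  fixes f :: "'a::topological_space \<Rightarrow> 'a"
  assumes "continuous_on S f" "f ` S \<subseteq> S" "open B"
  shows "openin (top_of_set S) (S \<inter> (f ^^ n) -` B)"
  using continuous_on_funpow[OF assms(1,2)] assms(3) by (rule continuous_openin_preimage_gen)

lemma Liminf_le_if_frequently:
  fixes f :: "'b \<Rightarrow> 'c::complete_linorder"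
  assumes "\<exists>\<^sub>F n in F. f n \<le> c"
  shows "Liminf F f \<le> c"
proof (rule ccontr)
  assume "\<not> Liminf F f \<le> c"
  then have "\<forall>\<^sub>F n in F. c < f n"
    by (intro less_LiminfD) simp
  with assms show False
    by (auto simp: frequently_def not_le)
qed

lemma le_Limsup_if_frequently:
  fixes f :: "'b \<Rightarrow> 'c::complete_linorder"
  assumes "\<exists>\<^sub>F n in F. c \<le> f n"
  shows "c \<le> Limsup F f"
proof (rule ccontr)
  assume "\<not> c \<le> Limsup F f"
  then have "\<forall>\<^sub>F n in F. f n < c"
    by (intro Limsup_lessD) simp
  with assms show False
    by (auto simp: frequently_def not_le)
qed

text \<open>
  Early hitting times can be removed by shrinking both sets: an opene \<open>V\<close> is infinite, so it
  contains a point \<open>v\<close> off the finite orbit segment of length \<open>k\<close> of some \<open>u \<in> U\<close>. By continuity a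
  neighbourhood of \<open>u\<close> stays away from a neighbourhood of \<open>v\<close> during the first \<open>k\<close> steps.
\<close>

lemma shrink_to_late_hitting_times:
  assumes dyn: "dynamical_system X T" and U: "opene X U" and V: "opene X V"
  obtains U' V' where "opene X U'" "U' \<subseteq> U" "opene X V'" "V' \<subseteq> V" "hitting_times T U' V' \<subseteq> {k..}"
proof -
  have cont: "continuous_on X T" and TX: "T ` X \<subseteq> X" and lim: "\<And>p. p \<in> X \<Longrightarrow> p islimpt X"
    using dyn by (auto simp: dynamical_system_def)
  obtain u where u: "u \<in> U" "u \<in> X"
    using U openin_subset by (fastforce simp: opene_def)
  define O' where "O' = (\<lambda>i. (T ^^ i) u) ` {..<k}"
  have "infinite V"
    using V lim openin_subset[of _ V] infinite_openin[of X V] by (fastforce simp: opene_def)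
  then obtain v where v: "v \<in> V" "v \<notin> O'"
    using finite_subset[of V O'] by (auto simp: O'_def)
  obtain d where d: "d > 0" "\<And>p. p \<in> O' \<Longrightarrow> d \<le> dist v p"
    using finite_set_avoid[of O' v] v by (metis O'_def finite_imageI finite_lessThan)
  define V' where "V' = V \<inter> ball v (d/2)"
  define U' where "U' = U \<inter> \<Inter> ((\<lambda>i. X \<inter> (T ^^ i) -` (- cball v (d/2))) ` {..<k})"
  have "openin (top_of_set X) U'"
    unfolding U'_def
    using U cont TX by (intro openin_Int_Inter) (auto simp: opene_def intro: openin_funpow_preimage)
  moreover have "u \<in> U'"
    using u d by (force simp: U'_def O'_def)
  moreover have "openin (top_of_set X) V'"
    using V by (auto simp: V'_def opene_def intro: openin_Int_open)
  moreover have "v \<in> V'"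
    using v d by (simp add: V'_def)
  moreover have "hitting_times T U' V' \<subseteq> {k..}"
  proof
    fix n assume "n \<in> hitting_times T U' V'"
    then obtain w where "w \<in> U'" "(T ^^ n) w \<in> V'"
      by (auto simp: hitting_times_def)
    then have "(T ^^ n) w \<in> ball v (d/2)" "\<And>i. i < k \<Longrightarrow> (T ^^ i) w \<notin> cball v (d/2)"
      by (auto simp: U'_def V'_def simp del: INT_simps mem_ball mem_cball)
    then show "n \<in> {k..}"
      using ball_subset_cball by (metis atLeast_iff not_le subsetD)
  qed
  moreover have "U' \<subseteq> U" "V' \<subseteq> V"
    by (auto simp: U'_def V'_def)
  ultimately show ?thesis
    by (intro that[of U' V']) (auto simp: opene_def)
qed

lemma simultaneous_visits_late:
  assumes dyn: "dynamical_system X T" and "z \<in> X"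
    and z: "\<And>G U V. neighborhood X z G \<Longrightarrow> opene X U \<Longrightarrow> opene X V \<Longrightarrow>
              visit_times T x G \<inter> hitting_times T U V \<noteq> {}"
    and "r > 0" and U: "opene X U" and V: "opene X V"
  obtains n u where "n \<ge> k" "dist z ((T ^^ n) x) < r" "u \<in> U" "(T ^^ n) u \<in> V"
proof -
  obtain U' V' where *: "opene X U'" "U' \<subseteq> U" "opene X V'" "V' \<subseteq> V" "hitting_times T U' V' \<subseteq> {k..}"
    using shrink_to_late_hitting_times[OF dyn U V] .
  have "neighborhood X z (X \<inter> ball z r)"
    using \<open>z \<in> X\<close> \<open>r > 0\<close> by (auto simp: neighborhood_def intro!: exI[of _ "X \<inter> ball z r"])
  then obtain n where "n \<in> visit_times T x (X \<inter> ball z r)" "n \<in> hitting_times T U' V'"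
    using z *(1,3) by blast
  then obtain u where "dist z ((T ^^ n) x) < r" "u \<in> U'" "(T ^^ n) u \<in> V'"
    by (auto simp: visit_times_def hitting_times_def)
  with * \<open>n \<in> hitting_times T U' V'\<close> show ?thesis
    by (intro that[of n u]) auto
qed

text \<open>
  For a fixed target \<open>v\<close> and a fixed \<open>k\<close>, asking for one common close visit after time \<open>k\<close> up to the
  error \<open>1 / (k + 1)\<close> cuts out an open set of points \<open>y\<close>, dense by the preceding lemma. Countably
  many such sets are intersected.
\<close>

lemma orbit_pair_accumulates:
  assumes dyn: "dynamical_system X T" and "z \<in> X"
    and z: "\<And>G U V. neighborhood X z G \<Longrightarrow> opene X U \<Longrightarrow> opene X V \<Longrightarrow>
              visit_times T x G \<inter> hitting_times T U V \<noteq> {}"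
    and C: "countable C" "C \<subseteq> X" and W: "opene X W"
  obtains y where "y \<in> W"
    "\<And>v e. v \<in> C \<Longrightarrow> e > 0 \<Longrightarrow>
       \<exists>\<^sub>F n in sequentially. dist z ((T ^^ n) x) < e \<and> dist v ((T ^^ n) y) < e"
proof -
  have cont: "continuous_on X T" and TX: "T ` X \<subseteq> X" and "compact X"
    using dyn by (auto simp: dynamical_system_def)
  define A where "A = (\<lambda>(v, k). \<Union>n\<in>{n. n \<ge> k \<and> dist z ((T ^^ n) x) < inverse (Suc k)}.
    X \<inter> (T ^^ n) -` ball v (inverse (Suc k)))"
  have openA: "openin (top_of_set X) (A p)" for p
    using cont TX by (cases p) (auto simp: A_def simp del: UN_simps intro!: openin_Union openin_funpow_preimage)
  have denseA: "A (v, k) \<inter> U \<noteq> {}" if "v \<in> C" and U: "opene X U" for v k U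
  proof -
    have V: "opene X (X \<inter> ball v (inverse (Suc k)))"
      using that C by (auto simp: opene_def intro!: exI[of _ v])
    obtain n u where "n \<ge> k" "dist z ((T ^^ n) x) < inverse (Suc k)" "u \<in> U"
        "(T ^^ n) u \<in> X \<inter> ball v (inverse (Suc k))"
      by (rule simultaneous_visits_late[OF dyn \<open>z \<in> X\<close> z _ U V]) auto
    moreover have "u \<in> X"
      using U \<open>u \<in> U\<close> openin_subset by (fastforce simp: opene_def)
    ultimately have "u \<in> A (v, k)"
      by (auto simp: A_def)
    with \<open>u \<in> U\<close> show ?thesis
      by blast
  qed
  have "completely_metrizable_space (top_of_set X) \<or>
      locally_compact_space (top_of_set X) \<and> regular_space (top_of_set X)"
    using \<open>compact X\<close> by (simp add: compact_imp_locally_compact_space compact_space_subtopology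
        compact_Hausdorff_imp_regular_space Hausdorff_space_subtopology)
  then have "top_of_set X closure_of \<Inter> (A ` (C \<times> UNIV)) = topspace (top_of_set X)"
  proof (rule Baire_category)
    show "countable (A ` (C \<times> UNIV))"
      using C by auto
    show "openin (top_of_set X) B \<and> top_of_set X closure_of B = topspace (top_of_set X)"
      if "B \<in> A ` (C \<times> UNIV)" for B
      using that openA denseA unfolding dense_intersects_open opene_def by blast
  qed
  then have "\<Inter> (A ` (C \<times> UNIV)) \<inter> W \<noteq> {}"
    using W unfolding dense_intersects_open opene_def by blast
  then obtain y where y: "y \<in> W" "\<And>v k. v \<in> C \<Longrightarrow> y \<in> A (v, k)"
    by blast
  show ?thesis
  proof (rule that[OF y(1)])
    fix v e assume "v \<in> C" "(e::real) > 0"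
    show "\<exists>\<^sub>F n in sequentially. dist z ((T ^^ n) x) < e \<and> dist v ((T ^^ n) y) < e"
      unfolding frequently_sequentially
    proof
      fix m
      obtain j where j: "inverse (Suc j) < e"
        using reals_Archimedean[OF \<open>e > 0\<close>] by blast
      \<comment> \<open>One index controls both the starting time and the error.\<close>
      define k where "k = max m j"
      have "inverse (Suc k) \<le> inverse (real (Suc j))"
        by (simp add: k_def field_simps)
      then have "inverse (Suc k) < e"
        using j by (rule le_less_trans)
      then show "\<exists>n\<ge>m. dist z ((T ^^ n) x) < e \<and> dist v ((T ^^ n) y) < e"
        using y(2)[OF \<open>v \<in> C\<close>, of k] by (force simp: A_def k_def)
    qed
  qed
qed

theorem theorem4p5:
  fixes X :: "'a::metric_space set" and T :: "'a \<Rightarrow> 'a"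
  assumes "dynamical_system X T"
    and "transitive_compact X T"
  shows "Li_Yorke_sensitive X T"
proof -
  obtain a b where ab: "a \<in> X" "b \<in> X" "a \<noteq> b"
    using assms(1) unfolding dynamical_system_def by blast
  show ?thesis
    unfolding Li_Yorke_sensitive_def
  \<comment> \<open>The upper limit will be at least half of \<open>dist a b\<close>; a third makes the inequality strict.\<close>
  proof (intro exI[of _ "dist a b / 3"] conjI ballI allI impI)
    show "dist a b / 3 > 0"
      using ab by simp
    fix x N assume "x \<in> X" and N: "neighborhood X x N"
    obtain z where "z \<in> X" and z: "\<And>G U V. neighborhood X z G \<Longrightarrow> opene X U \<Longrightarrow> opene X V \<Longrightarrow>
        visit_times T x G \<inter> hitting_times T U V \<noteq> {}"
      using assms(2) \<open>x \<in> X\<close> unfolding transitive_compact_def by meson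
    obtain w where w: "w \<in> X" "dist z w \<ge> dist a b / 2"
    proof (cases "dist z a \<ge> dist a b / 2")
      case False
      then have "dist z b \<ge> dist a b / 2"
        using dist_triangle3[of a b z] by linarith
      with ab that show ?thesis by blast
    qed (use ab that in blast)
    obtain W where W: "opene X W" "W \<subseteq> N"
      using N by (auto simp: neighborhood_def opene_def)
    obtain y where "y \<in> W" and y: "\<And>v e. v \<in> {z, w} \<Longrightarrow> e > 0 \<Longrightarrow>
        \<exists>\<^sub>F n in sequentially. dist z ((T ^^ n) x) < e \<and> dist v ((T ^^ n) y) < e"
      using orbit_pair_accumulates[OF assms(1) \<open>z \<in> X\<close> z, of "{z, w}" W] \<open>z \<in> X\<close> w W by auto
    let ?d = "\<lambda>n. ereal (dist ((T ^^ n) x) ((T ^^ n) y))"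
    have "liminf ?d \<le> 0"
    proof (rule ereal_le_epsilon2)
      fix e :: real assume "e > 0"
      then have "\<exists>\<^sub>F n in sequentially. dist z ((T ^^ n) x) < e/2 \<and> dist z ((T ^^ n) y) < e/2"
        by (intro y) auto
      then have "\<exists>\<^sub>F n in sequentially. ?d n \<le> ereal e"
        by (rule frequently_elim1) (auto intro!: less_imp_le[OF dist_triangle_half_r])
      then show "liminf ?d \<le> 0 + ereal e"
        using Liminf_le_if_frequently[of ?d "ereal e"] by simp
    qed
    moreover have "liminf ?d \<ge> 0"
      by (intro Liminf_bounded) auto
    moreover have "limsup ?d > ereal (dist a b / 3)"
    proof -
      \<comment> \<open>Both orbits contribute an error \<open>e\<close>, so \<open>e\<close> is half of
        \<open>(1/2 - 2/5) * dist a b\<close>; the bound \<open>2/5\<close> exceeds \<open>1/3\<close>.\<close>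
      define e where "e = dist a b / 20"
      have "\<exists>\<^sub>F n in sequentially. ereal (2 * dist a b / 5) \<le> ?d n"
      proof (rule frequently_elim1)
        show "\<exists>\<^sub>F n in sequentially. dist z ((T ^^ n) x) < e \<and> dist w ((T ^^ n) y) < e"
          using ab by (intro y) (auto simp: e_def)
        fix n assume n: "dist z ((T ^^ n) x) < e \<and> dist w ((T ^^ n) y) < e"
        have "dist z w \<le> dist z ((T ^^ n) x) + dist ((T ^^ n) x) ((T ^^ n) y) + dist w ((T ^^ n) y)"
          using dist_triangle[of z w "(T ^^ n) x"] dist_triangle2[of "(T ^^ n) x" w "(T ^^ n) y"]
          by linarith
        with n w show "ereal (2 * dist a b / 5) \<le> ?d n"
          by (simp add: e_def)
      qed
      then have "ereal (2 * dist a b / 5) \<le> limsup ?d"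
        by (rule le_Limsup_if_frequently)
      moreover have "ereal (dist a b / 3) < ereal (2 * dist a b / 5)"
        using ab by simp
      ultimately show ?thesis
        by (rule less_le_trans[rotated])
    qed
    ultimately show "\<exists>y\<in>N. liminf (\<lambda>n. ereal (dist ((T ^^ n) x) ((T ^^ n) y))) = 0 \<and>
        limsup (\<lambda>n. ereal (dist ((T ^^ n) x) ((T ^^ n) y))) > ereal (dist a b / 3)"
      using \<open>y \<in> W\<close> W by (intro bexI[of _ y]) auto
  qed
qed

end
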